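(* Let $A$ be a non-archimedean frame with non-archimedean base $\mathcal{B}$. Then $A$ has a base which, ordered by the reverse of the order of $A$, is a tree.
   Context: A frame is a complete lattice $A$ in which $a\wedge\bigvee X=\bigvee\{a\wedge x\mid x\in X\}$ for all $a\in A$, $X\subseteq A$. The negation of $a$ is $\neg a=\bigvee\{x\mid x\wedge a=0\}$; $x\prec a$ means $\neg x\vee a=1$; $A$ is regular if $a=\bigvee\{x\in A\mid x\prec a\}$ for every $a\in A$. A subset $\mathcal{B}\subseteq A$ is a base of $A$ if $a=\bigvee\{b\in\mathcal{B}\mid b\le a\}$ for every $a\in A$. A base $\mathcal{B}$ is non-archimedean if for all $b_1,b_2\in\mathcal{B}$ at least one of $b_1\wedge b_2=0$, $b_1\le b_2$, $b_2\le b_1$ holds. A non-archimedean frame is a regular frame that has a non-archimedean base. A tree is a partially ordered set $(T,\sqsubseteq)$ such that for each $a\in T$ the set $\{x\in T\mid x\sqsubset a\}$ is well-ordered. *)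

theory Defs
  imports Main
begin

text \<open>
  A frame is taken to be a type of class \<open>frame\<close>, its carrier being the whole type. The library
  class \<open>complete_distrib_lattice\<close> is too strong: it demands complete distributivity.
\<close>

class frame = complete_lattice +
  assumes inf_Sup_distrib: "inf a (Sup X) = (SUP x\<in>X. inf a x)"
begin

definition pseudocomplement :: "'a \<Rightarrow> 'a" where
  "pseudocomplement a = Sup {x. inf x a = bot}"

definition rather_below :: "'a \<Rightarrow> 'a \<Rightarrow> bool" where
  "rather_below x a \<longleftrightarrow> sup (pseudocomplement x) a = top"

definition frame_base :: "'a set \<Rightarrow> bool" where
  "frame_base B \<longleftrightarrow> (\<forall>a. a = Sup {b \<in> B. b \<le> a})"

definition non_archimedean_base :: "'a set \<Rightarrow> bool" where
  "non_archimedean_base B \<longleftrightarrow> frame_base B \<and>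
     (\<forall>b1\<in>B. \<forall>b2\<in>B. inf b1 b2 = bot \<or> b1 \<le> b2 \<or> b2 \<le> b1)"

end

class regular_frame = frame +
  assumes regular: "a = Sup {x. rather_below x a}"

class non_archimedean_frame = regular_frame +
  assumes ex_non_archimedean_base: "\<exists>B. non_archimedean_base B"

definition strict_predecessors :: "'b set \<Rightarrow> ('b \<times> 'b) set \<Rightarrow> 'b \<Rightarrow> 'b set" where
  "strict_predecessors T r a = {x \<in> T. (x, a) \<in> r \<and> x \<noteq> a}"

definition tree_order_on :: "'b set \<Rightarrow> ('b \<times> 'b) set \<Rightarrow> bool" where
  "tree_order_on T r \<longleftrightarrow> partial_order_on T r \<and>
     (\<forall>a\<in>T. well_order_on (strict_predecessors T r a) (Restr r (strict_predecessors T r a)))"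

text \<open>A pair \<open>(x, y)\<close> in a relation means that \<open>x\<close> is below \<open>y\<close>; here this is \<open>y \<le> x\<close> in the frame.\<close>

definition reverse_order_on :: "'b::order set \<Rightarrow> ('b \<times> 'b) set" where
  "reverse_order_on T = {(x, y). x \<in> T \<and> y \<in> T \<and> y \<le> x}"

end

theory Submission
  imports Defs
begin

text \<open>
  By Zorn, enlarge the given base to a maximal non-archimedean family \<open>M\<close> of nonzero elements;
  maximality makes \<open>M\<close> closed under nonzero meets and under joins of chains. Regularity makes every
  element of \<open>M\<close> complemented. Hence each \<open>b \<in> M\<close> that is not minimal in \<open>M\<close> is partitioned by its
  \<^emph>\<open>children\<close>: fix \<open>c \<in> M\<close> with \<open>c < b\<close> and take the maximal elements of \<open>M\<close> below \<open>b\<close> that lie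
  below \<open>c\<close> or are disjoint from \<open>c\<close>. The tree is the least set closed under nonzero meets and
  children. As two elements of \<open>M\<close> with nonzero meet are comparable, Zermelo's argument for towers
  shows that nothing in the tree lies strictly between a node and its children, so the elements
  above a given one are well-ordered by \<open>\<ge>\<close>. If \<open>z\<close> is the least node above \<open>b \<in> M\<close> and \<open>z \<noteq> b\<close>, then
  \<open>b\<close> lies below no child of \<open>z\<close> and is therefore the join of the children of \<open>z\<close> that it meets.
\<close>

section \<open>Meets, pseudocomplements and bases in a frame\<close>

lemma inf_sup_distrib_frame:
  fixes a :: "'a::frame"
  shows "inf a (sup x y) = sup (inf a x) (inf a y)"
  using inf_Sup_distrib[of a "{x, y}"] by simp

lemma inf_pseudocomplement: "inf a (pseudocomplement a) = (bot :: 'a::frame)"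
  unfolding pseudocomplement_def inf_Sup_distrib
  by (rule antisym) (auto intro!: SUP_least simp: inf_commute)

lemma le_pseudocomplement: "inf x a = bot \<Longrightarrow> x \<le> pseudocomplement (a :: 'a::frame)"
  unfolding pseudocomplement_def by (rule Sup_upper) simp

lemma inf_Sup_neq_bot:
  fixes a :: "'a::frame"
  assumes "inf a (Sup X) \<noteq> bot"
  obtains x where "x \<in> X" "inf a x \<noteq> bot"
proof -
  have "(SUP x\<in>X. inf a x) = bot" if "\<And>x. x \<in> X \<Longrightarrow> inf a x = bot"
    using that by (intro antisym SUP_least) auto
  then show thesis using assms that unfolding inf_Sup_distrib by blast
qed

lemma frame_baseI:
  assumes "\<And>a. a \<le> Sup {b \<in> B. b \<le> (a :: 'a::frame)}"
  shows "frame_base B"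
  unfolding frame_base_def using assms by (auto intro!: antisym Sup_least)

lemma frame_base_leI:
  assumes "frame_base B" "\<And>b. b \<in> B \<Longrightarrow> b \<le> a \<Longrightarrow> b \<le> u"
  shows "a \<le> (u :: 'a::frame)"
proof -
  have "Sup {b \<in> B. b \<le> a} \<le> u" using assms(2) by (auto intro: Sup_least)
  then show ?thesis using assms(1) unfolding frame_base_def by metis
qed

lemma frame_base_refine:
  assumes "frame_base B" "\<And>b. b \<in> B \<Longrightarrow> b \<le> Sup {c \<in> C. c \<le> (b :: 'a::frame)}"
  shows "frame_base C"
proof (rule frame_baseI, rule frame_base_leI[OF assms(1)])
  fix a b assume b: "b \<in> B" "b \<le> a"
  have "Sup {c \<in> C. c \<le> b} \<le> Sup {c \<in> C. c \<le> a}"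
    using b by (intro Sup_subset_mono) auto
  then show "b \<le> Sup {c \<in> C. c \<le> a}" using assms(2)[OF b(1)] by (rule order_trans[rotated])
qed

text \<open>For nonzero \<open>b\<close>, regularity gives a nonzero \<open>x\<close> rather below
  \<open>b\<close>. A base element under the pseudocomplement of \<open>x\<close> cannot lie above
  \<open>b\<close>, so it lies below \<open>b\<close> or is disjoint from \<open>b\<close>.\<close>

lemma non_archimedean_base_complemented:
  fixes b :: "'a::regular_frame"
  assumes "non_archimedean_base B" "b \<in> B"
  shows "sup b (pseudocomplement b) = top"
proof (cases "b = bot")
  case True
  then have "top \<le> pseudocomplement b" by (intro le_pseudocomplement) simp
  then show ?thesis by (simp add: top_unique)
next
  case False
  have base: "frame_base B" using assms(1) by (simp add: non_archimedean_base_def)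
  obtain x where x: "rather_below x b" "x \<noteq> bot"
  proof (rule ccontr)
    assume "\<not> thesis"
    then have "\<And>x. rather_below x b \<Longrightarrow> x = bot" using that by blast
    then have "Sup {x. rather_below x b} \<le> bot" by (intro Sup_least) auto
    then show False using regular[of b] False by (metis bot_unique)
  qed
  have xb: "sup (pseudocomplement x) b = top" using x by (simp add: rather_below_def)
  \<comment> \<open>Meeting the cover \<open>xb\<close> with \<open>x\<close> leaves only
    \<open>inf x b\<close>.\<close>
  have "x \<le> b"
    using inf_sup_distrib_frame[of x "pseudocomplement x" b] xb
    by (simp add: inf_pseudocomplement le_iff_inf)
  have "d \<le> sup b (pseudocomplement b)" if "d \<in> B" "d \<le> pseudocomplement x" for d
  proof -
    have "\<not> b \<le> d"
    proof
      assume "b \<le> d"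
      then have "x \<le> inf x (pseudocomplement x)" using \<open>x \<le> b\<close> that by auto
      then show False using x(2) inf_pseudocomplement[of x] by (simp add: bot_unique)
    qed
    then have "inf d b = bot \<or> d \<le> b"
      using assms that unfolding non_archimedean_base_def by blast
    then show ?thesis by (auto intro: le_supI1 le_supI2 le_pseudocomplement)
  qed
  then have "pseudocomplement x \<le> sup b (pseudocomplement b)"
    using frame_base_leI[OF base] by blast
  then have "sup (pseudocomplement x) b \<le> sup b (pseudocomplement b)" by simp
  then show ?thesis using xb by (simp add: top_unique)
qed

section \<open>Maximal non-archimedean families and their closure properties\<close>

definition non_archimedean_family :: "'a::frame set \<Rightarrow> bool" where
  "non_archimedean_family M \<longleftrightarrow> bot \<notin> M \<and>
     (\<forall>x\<in>M. \<forall>y\<in>M. inf x y = bot \<or> x \<le> y \<or> y \<le> x)"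

lemma ex_maximal_non_archimedean_family:
  assumes "non_archimedean_family B"
  obtains M where "B \<subseteq> M" "non_archimedean_family M"
    "\<And>N. non_archimedean_family N \<Longrightarrow> M \<subseteq> N \<Longrightarrow> N = M"
proof -
  let ?F = "{N. non_archimedean_family N \<and> B \<subseteq> N}"
  have "\<exists>U\<in>?F. \<forall>X\<in>C. X \<subseteq> U" if "subset.chain ?F C" for C
  proof (cases "C = {}")
    case True
    then show ?thesis using assms by auto
  next
    case False
    have C: "\<And>X. X \<in> C \<Longrightarrow> non_archimedean_family X \<and> B \<subseteq> X"
      and lin: "\<And>X Y. X \<in> C \<Longrightarrow> Y \<in> C \<Longrightarrow> X \<subseteq> Y \<or> Y \<subseteq> X"
      using that unfolding subset_chain_def by blast+
    have "inf x y = bot \<or> x \<le> y \<or> y \<le> x" if xy: "x \<in> \<Union>C" "y \<in> \<Union>C" for x y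
    proof -
      obtain X Y where "X \<in> C" "Y \<in> C" "x \<in> X" "y \<in> Y" using xy by blast
      then obtain Z where "Z \<in> C" "x \<in> Z" "y \<in> Z" using lin by blast
      then show ?thesis using C unfolding non_archimedean_family_def by blast
    qed
    then have "non_archimedean_family (\<Union>C)"
      using C unfolding non_archimedean_family_def by blast
    then show ?thesis using False C by blast
  qed
  from subset_Zorn[of ?F, OF this]
  obtain M where "M \<in> ?F" and max: "\<forall>X\<in>?F. M \<subseteq> X \<longrightarrow> X = M" ..
  then have M: "B \<subseteq> M" "non_archimedean_family M" by simp_all
  show thesis
  proof (rule that[OF M])
    fix N assume "non_archimedean_family N" "M \<subseteq> N"
    then show "N = M" using max M(1) by (metis (mono_tags, lifting) mem_Collect_eq order_trans)
  qed
qed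

locale maximal_non_archimedean_base =
  fixes M :: "'a::regular_frame set"
  assumes base: "frame_base M"
    and family: "non_archimedean_family M"
    and maximal: "\<And>N. non_archimedean_family N \<Longrightarrow> M \<subseteq> N \<Longrightarrow> N = M"
begin

lemma nonzero: "x \<in> M \<Longrightarrow> x \<noteq> bot"
  using family by (auto simp: non_archimedean_family_def)

lemma comparable: "x \<in> M \<Longrightarrow> y \<in> M \<Longrightarrow> inf x y \<noteq> bot \<Longrightarrow> x \<le> y \<or> y \<le> x"
  using family by (auto simp: non_archimedean_family_def)

lemma comparable_above:
  assumes "x \<in> M" "y \<in> M" "b \<noteq> bot" "b \<le> x" "b \<le> y"
  shows "x \<le> y \<or> y \<le> x"
  using comparable[OF assms(1,2)] assms(3-5) by (metis bot_unique le_inf_iff)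

text \<open>Adjoining \<open>m\<close> leaves the family non-archimedean, so by maximality
  \<open>m\<close> is already a member.\<close>

lemma memI:
  assumes "m \<noteq> bot" "\<And>x. x \<in> M \<Longrightarrow> inf m x \<noteq> bot \<Longrightarrow> m \<le> x \<or> x \<le> m"
  shows "m \<in> M"
proof -
  have "inf x m = bot \<or> x \<le> m \<or> m \<le> x" if "x \<in> M" for x
    using assms(2)[OF that] by (auto simp: inf_commute)
  then have "non_archimedean_family (insert m M)"
    using family assms unfolding non_archimedean_family_def by blast
  then show ?thesis using maximal by blast
qed

text \<open>If \<open>y\<close> meets \<open>Inf X\<close>, it is comparable with every member of
  \<open>X\<close>. Either \<open>y\<close> is below all of them, or one of them, hence also
  \<open>Inf X\<close>, is below \<open>y\<close>.\<close>

lemma Inf_closed: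
  assumes "X \<subseteq> M" "Inf X \<noteq> bot"
  shows "Inf X \<in> M"
proof (rule memI[OF assms(2)])
  fix y assume y: "y \<in> M" "inf (Inf X) y \<noteq> bot"
  have "x \<le> y \<or> y \<le> x" if "x \<in> X" for x
    using comparable_above[of x y "inf (Inf X) y"] assms that y
    by (auto intro: le_infI1 Inf_lower)
  then show "Inf X \<le> y \<or> y \<le> Inf X"
    by (meson Inf_greatest Inf_lower2)
qed

text \<open>If \<open>y\<close> meets the join, it meets some \<open>x\<close> in the chain. When no
  member is above \<open>y\<close>, members above \<open>x\<close> also meet \<open>y\<close> and so
  lie below it; members below \<open>x\<close> do too, because \<open>x\<close> does.\<close>

lemma chain_Sup_closed:
  assumes "X \<subseteq> M" "d \<in> X" "\<And>x y. x \<in> X \<Longrightarrow> y \<in> X \<Longrightarrow> x \<le> y \<or> y \<le> x"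
  shows "Sup X \<in> M"
proof (rule memI)
  show "Sup X \<noteq> bot" using assms nonzero by (metis Sup_upper bot_unique subsetD)
next
  fix y assume y: "y \<in> M" "inf (Sup X) y \<noteq> bot"
  then obtain x where x: "x \<in> X" "inf y x \<noteq> bot"
    using inf_Sup_neq_bot by (metis inf_commute)
  show "Sup X \<le> y \<or> y \<le> Sup X"
  proof (cases "\<exists>x'\<in>X. y \<le> x'")
    case True
    then show ?thesis by (meson Sup_upper2)
  next
    case False
    have "x' \<le> y" if "x' \<in> X" for x'
      using assms(3)[OF x(1) that]
    proof
      assume "x \<le> x'"
      then have "inf y x \<le> inf y x'" by (rule inf_mono[OF order_refl])
      then have "inf y x' \<noteq> bot" using x(2) by (metis bot_unique)
      then show ?thesis using comparable[OF y(1)] that assms(1) False by blast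
    next
      assume "x' \<le> x"
      moreover have "x \<le> y" using comparable[OF y(1)] x assms(1) False by blast
      ultimately show ?thesis by simp
    qed
    then show ?thesis by (simp add: Sup_least)
  qed
qed

section \<open>Splitting an element of the family into children\<close>

definition split :: "'a \<Rightarrow> 'a" where
  "split b = (SOME c. c \<in> M \<and> c < b)"

text \<open>When \<open>b\<close> is minimal in \<open>M\<close>, the choice \<open>split b\<close>
  is unspecified, but this set is then empty.\<close>

definition pieces :: "'a \<Rightarrow> 'a set" where
  "pieces b = {d \<in> M. d < b \<and> (d \<le> split b \<or> inf d (split b) = bot)}"

definition children :: "'a \<Rightarrow> 'a set" where
  "children b = {k \<in> pieces b. \<forall>d\<in>pieces b. k \<le> d \<longrightarrow> d = k}"

lemma children_mem: "k \<in> children b \<Longrightarrow> k \<in> M"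
  and children_less: "k \<in> children b \<Longrightarrow> k < b"
  by (auto simp: children_def pieces_def)

lemma children_eq:
  assumes "k \<in> children b" "k' \<in> children b" "x \<noteq> bot" "x \<le> k" "x \<le> k'"
  shows "k = k'"
  using comparable_above[of k k' x] assms children_mem
  by (auto simp: children_def)

text \<open>The pieces above \<open>d\<close> share the nonzero \<open>d\<close>, so they form a
  chain. Their join is in \<open>M\<close> and is again a piece, hence a maximal one.\<close>

lemma piece_le_child:
  assumes "d \<in> pieces b"
  obtains k where "k \<in> children b" "d \<le> k"
proof -
  let ?X = "{e \<in> pieces b. d \<le> e}" and ?c = "split b"
  have d: "d \<in> M" "d < b" using assms by (auto simp: pieces_def)
  have ub: "Sup ?X \<in> M"
    using assms by (intro chain_Sup_closed[of ?X d] comparable_above[OF _ _ nonzero[OF d(1)]])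
      (auto simp: pieces_def)
  have c: "?c \<in> M \<and> ?c < b"
    unfolding split_def by (rule someI[of _ d]) (use d in blast)
  have "Sup ?X \<le> b" by (rule Sup_least) (auto simp: pieces_def)
  \<comment> \<open>All pieces above \<open>d\<close> lie on the same side of \<open>?c\<close> as
    \<open>d\<close>: if \<open>d \<le> ?c\<close> they meet \<open>?c\<close>, otherwise they
    cannot lie below it.\<close>
  have cases: "Sup ?X \<le> ?c \<or> inf (Sup ?X) ?c = bot"
  proof (cases "d \<le> ?c")
    case True
    have "e \<le> ?c" if "e \<in> ?X" for e
    proof -
      have "d \<le> inf e ?c" using that True by simp
      then have "inf e ?c \<noteq> bot" using nonzero[OF d(1)] by (metis bot_unique)
      then show ?thesis using that by (simp add: pieces_def)
    qed
    then have "Sup ?X \<le> ?c" by (rule Sup_least)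
    then show ?thesis ..
  next
    case False
    have "inf ?c e = bot" if "e \<in> ?X" for e
    proof -
      have "\<not> e \<le> ?c" using that False by auto
      then show ?thesis using that by (simp add: pieces_def inf_commute)
    qed
    then have "inf ?c (Sup ?X) = bot" using inf_Sup_neq_bot[of ?c ?X] by blast
    then show ?thesis by (simp add: inf_commute)
  qed
  have "Sup ?X \<noteq> b"
  proof
    assume "Sup ?X = b"
    then have "inf b ?c = bot" using cases c by (auto simp: less_le_not_le)
    then show False using c nonzero[of ?c] by (simp add: inf.absorb4)
  qed
  then have piece: "Sup ?X \<in> pieces b"
    using ub \<open>Sup ?X \<le> b\<close> cases by (simp add: pieces_def)
  have "d \<le> Sup ?X" using assms by (intro Sup_upper) simp
  moreover have "Sup ?X \<in> children b"
    unfolding children_def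
    using piece \<open>d \<le> Sup ?X\<close> by (auto intro!: antisym Sup_upper)
  ultimately show thesis using that by blast
qed

text \<open>Since \<open>split b\<close> is complemented, it cuts \<open>b\<close> in two. One part
  is \<open>split b\<close>, itself a piece; the other is a join of members of \<open>M\<close>
  disjoint from \<open>split b\<close>, which are pieces as well.\<close>

lemma children_cover:
  assumes "c' \<in> M" "c' < b"
  shows "b \<le> Sup (children b)"
proof -
  let ?c = "split b"
  have c: "?c \<in> M \<and> ?c < b"
    unfolding split_def by (rule someI[of _ c']) (use assms in blast)
  have piece: "d \<le> Sup (children b)" if "d \<in> pieces b" for d
    by (rule piece_le_child[OF that]) (rule Sup_upper2)
  have "b = inf b (sup ?c (pseudocomplement ?c))"
    using non_archimedean_base_complemented[of M ?c] c base family
    by (simp add: non_archimedean_base_def non_archimedean_family_def)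
  also have "\<dots> = sup (inf b ?c) (inf b (pseudocomplement ?c))"
    by (rule inf_sup_distrib_frame)
  also have "\<dots> \<le> Sup (children b)"
  proof (rule sup_least)
    show "inf b ?c \<le> Sup (children b)"
      using c piece[of ?c] by (simp add: pieces_def le_infI2)
    show "inf b (pseudocomplement ?c) \<le> Sup (children b)"
    proof (rule frame_base_leI[OF base])
      fix d assume d: "d \<in> M" "d \<le> inf b (pseudocomplement ?c)"
      have "inf d ?c \<le> inf ?c (pseudocomplement ?c)" using d by (auto intro: le_infI1)
      then have disj: "inf d ?c = bot" by (simp add: inf_pseudocomplement bot_unique)
      have "d \<noteq> b"
      proof
        assume "d = b"
        then show False using disj c nonzero[of ?c] by (simp add: inf.absorb4)
      qed
      then show "d \<le> Sup (children b)"
        using d disj by (intro piece) (simp add: pieces_def less_le)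
    qed
  qed
  finally show ?thesis .
qed

text \<open>The root \<open>top\<close> is the meet of the empty set.\<close>

inductive_set tree :: "'a set" where
  Inf: "(\<And>x. x \<in> X \<Longrightarrow> x \<in> tree) \<Longrightarrow> Inf X \<noteq> bot \<Longrightarrow> Inf X \<in> tree"
| child: "x \<in> tree \<Longrightarrow> k \<in> children x \<Longrightarrow> k \<in> tree"

section \<open>Relative position of two nodes\<close>

lemma tree_mem: "x \<in> tree \<Longrightarrow> x \<in> M"
proof (induction rule: tree.induct)
  case (Inf X)
  then show ?case by (auto intro: Inf_closed)
qed (rule children_mem)

text \<open>The assumption on \<open>x\<close> is the analogue of comparability in Zermelo's
  argument. The induction on \<open>y\<close> carries the three alternatives through meets and
  children.\<close>

lemma tree_trichotomy_aux:
  assumes "y \<in> tree" "x \<in> tree"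
    and x: "\<And>y. y \<in> tree \<Longrightarrow> x < y \<Longrightarrow> \<exists>k\<in>children y. x \<le> k"
  shows "x \<le> y \<or> inf x y = bot \<or> (\<exists>k\<in>children x. y \<le> k)"
  using assms(1)
proof (induction rule: tree.induct)
  case (Inf X)
  have lower: "inf x (Inf X) = bot" if "y \<in> X" "inf x y = bot" for y
    using that by (metis Inf_lower bot_unique inf_mono order_refl)
  have "x \<le> Inf X" if "\<And>y. y \<in> X \<Longrightarrow> x \<le> y" using that by (rule Inf_greatest)
  then show ?case using Inf.IH lower by (meson Inf_lower2)
next
  case (child y k)
  from child.IH show ?case
  proof (elim disjE)
    assume "x \<le> y"
    show ?thesis
    proof (cases "x = y")
      case True
      then show ?thesis using child.hyps by blast
    next
      case False
      then have "x < y" using \<open>x \<le> y\<close> by simp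
      then obtain k' where k': "k' \<in> children y" "x \<le> k'"
        using x[OF child.hyps(1)] by blast
      \<comment> \<open>Distinct children of \<open>y\<close> are disjoint, and \<open>x\<close>
        lies under \<open>k'\<close>.\<close>
      have "inf x k = bot \<or> k = k'"
        using children_eq[OF child.hyps(2) k'(1), of "inf x k"] k'(2) by (auto intro: le_infI1)
      then show ?thesis using k' by blast
    qed
  next
    assume "inf x y = bot"
    moreover have "inf x k \<le> inf x y"
      using children_less[OF child.hyps(2)] by (intro inf_mono) auto
    ultimately show ?thesis by (simp add: bot_unique)
  next
    assume "\<exists>k'\<in>children x. y \<le> k'"
    then show ?thesis using children_less[OF child.hyps(2)] by (meson less_imp_le order_trans)
  qed
qed

text \<open>Induction on \<open>x\<close> discharges the assumption of the trichotomy. For a child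
  \<open>k\<close> of \<open>x\<close> with \<open>k < y\<close>, the trichotomy leaves only
  \<open>x \<le> y\<close>.\<close>

lemma tree_less_imp_le_child:
  assumes "x \<in> tree" "y \<in> tree" "x < y"
  shows "\<exists>k\<in>children y. x \<le> k"
  using assms
proof (induction arbitrary: y rule: tree.induct)
  case (Inf X)
  \<comment> \<open>If all members of \<open>X\<close> were above \<open>y\<close>, then
    \<open>y \<le> Inf X\<close>, against \<open>Inf X < y\<close>.\<close>
  then obtain x where x: "x \<in> X" "\<not> y \<le> x"
    by (meson Inf_greatest leD)
  then have "x \<le> y"
    using comparable_above[OF tree_mem[OF Inf.hyps(1)[OF x(1)]] tree_mem[OF Inf.prems(1)] Inf.hyps(2)
        Inf_lower[OF x(1)] less_imp_le[OF Inf.prems(2)]] by blast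
  then have "\<exists>k\<in>children y. x \<le> k" using Inf.IH[OF x(1) Inf.prems(1)] x by (simp add: less_le_not_le)
  then show ?case using x(1) by (meson Inf_lower2)
next
  case (child x k)
  have kx: "k < x" using child.hyps(2) by (rule children_less)
  have k: "k \<noteq> bot" using child.hyps(2) children_mem nonzero by blast
  have "\<not> inf x y = bot"
  proof
    assume "inf x y = bot"
    moreover have "k \<le> inf x y" using kx child.prems(2) by (simp add: less_imp_le)
    ultimately show False using k by (simp add: bot_unique)
  qed
  moreover have "\<not> y \<le> k'" if "k' \<in> children x" for k'
  proof
    assume "y \<le> k'"
    moreover have "k = k'"
      using children_eq[OF child.hyps(2) that k] child.prems(2) \<open>y \<le> k'\<close> by auto
    ultimately show False using child.prems(2) by simp
  qed
  ultimately have "x \<le> y"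
    using tree_trichotomy_aux[OF child.prems(1) child.hyps(1) child.IH] by blast
  show ?case
  proof (cases "x = y")
    case True
    then show ?thesis using child.hyps(2) by blast
  next
    case False
    then have "\<exists>k'\<in>children y. x \<le> k'" using child.IH[OF child.prems(1)] \<open>x \<le> y\<close> by simp
    then show ?thesis using kx by (meson less_imp_le order_trans)
  qed
qed

section \<open>Well-ordering and the base property of the tree\<close>

lemma tree_Inf_above:
  assumes "b \<noteq> bot" "b \<le> u"
  shows "Inf {z \<in> tree. u \<le> z} \<in> tree"
proof (rule tree.Inf)
  have "b \<le> Inf {z \<in> tree. u \<le> z}" using assms by (auto intro: Inf_greatest)
  then show "Inf {z \<in> tree. u \<le> z} \<noteq> bot" using assms(1) by (auto simp: bot_unique)
qed simp

text \<open>Let \<open>z\<close> be the least node above \<open>Sup Y\<close>. If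
  \<open>Sup Y\<close> is not in \<open>Y\<close>, every member of \<open>Y\<close> lies under a
  child of \<open>z\<close>, and always the same child, as all contain \<open>b\<close>. That child
  is then a smaller node above \<open>Sup Y\<close>.\<close>

lemma tree_has_greatest:
  assumes "b \<noteq> bot" "Y \<subseteq> tree" "y \<in> Y" "\<And>y. y \<in> Y \<Longrightarrow> b \<le> y"
  shows "Sup Y \<in> Y"
proof (rule ccontr)
  assume notin: "Sup Y \<notin> Y"
  define z where "z = Inf {z \<in> tree. Sup Y \<le> z}"
  have "b \<le> Sup Y" using assms(3,4) by (meson Sup_upper2)
  then have z: "z \<in> tree" unfolding z_def by (rule tree_Inf_above[OF assms(1)])
  have Yz: "Sup Y \<le> z" unfolding z_def by (auto intro: Inf_greatest)
  have below: "\<exists>k\<in>children z. y' \<le> k" if "y' \<in> Y" for y'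
  proof (rule tree_less_imp_le_child)
    have "y' \<noteq> z" using notin Yz that by (metis Sup_upper antisym)
    then show "y' < z" using Yz that by (meson Sup_upper2 Sup_le_iff le_neq_trans)
  qed (use that assms(2) z in auto)
  then obtain k where k: "k \<in> children z" "y \<le> k" using assms(3) by blast
  have "y' \<le> k" if y': "y' \<in> Y" for y'
  proof -
    obtain k' where k': "k' \<in> children z" "y' \<le> k'" using below[OF y'] by blast
    have "k = k'"
      using children_eq[OF k(1) k'(1) assms(1)] assms(4)[OF assms(3)] assms(4)[OF y'] k k' by simp
    then show ?thesis using k' by simp
  qed
  then have "Sup Y \<le> k" by (rule Sup_least)
  then have "z \<le> k"
    unfolding z_def using tree.child[OF z k(1)] by (intro Inf_lower) simp
  then show False using children_less[OF k(1)] by simp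
qed

lemma tree_frame_base: "frame_base tree"
proof (rule frame_base_refine[OF base])
  fix b assume b: "b \<in> M"
  define z where "z = Inf {z \<in> tree. b \<le> z}"
  have z: "z \<in> tree" unfolding z_def using nonzero[OF b] by (rule tree_Inf_above) simp
  have "b \<le> z" unfolding z_def by (auto intro: Inf_greatest)
  show "b \<le> Sup {c \<in> tree. c \<le> b}"
  proof (cases "b = z")
    case True
    then show ?thesis using z by (auto intro: Sup_upper)
  next
    case False
    then have "b < z" using \<open>b \<le> z\<close> by simp
    \<comment> \<open>A child of \<open>z\<close> above \<open>b\<close> would be a node above
      \<open>b\<close> smaller than \<open>z\<close>.\<close>
    have notle: "\<not> b \<le> k" if "k \<in> children z" for k
    proof
      assume "b \<le> k"
      then have "z \<le> k"
        unfolding z_def using tree.child[OF z that] by (intro Inf_lower) simp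
      then show False using children_less[OF that] by simp
    qed
    have "b = inf b (Sup (children z))"
      using children_cover[OF b \<open>b < z\<close>] \<open>b \<le> z\<close> by (metis inf.absorb1 order_trans)
    also have "\<dots> \<le> Sup {c \<in> tree. c \<le> b}"
      unfolding inf_Sup_distrib
    proof (rule SUP_least)
      fix k assume k: "k \<in> children z"
      show "inf b k \<le> Sup {c \<in> tree. c \<le> b}"
      proof (cases "inf b k = bot")
        case False
        then have "k \<le> b" using comparable[OF b children_mem[OF k]] notle[OF k] by blast
        then show ?thesis using tree.child[OF z k] by (auto intro: le_infI2 Sup_upper)
      qed simp
    qed
    finally show ?thesis .
  qed
qed

lemma tree_tree_order: "tree_order_on tree (reverse_order_on tree)"
  unfolding tree_order_on_def
proof (intro conjI ballI)
  show "partial_order_on tree (reverse_order_on tree)"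
    by (auto simp: partial_order_on_def preorder_on_def refl_on_def reverse_order_on_def
        intro!: transI antisymI)
  fix a assume a: "a \<in> tree"
  let ?S = "strict_predecessors tree (reverse_order_on tree) a"
  let ?r = "Restr (reverse_order_on tree) ?S"
  have S: "?S \<subseteq> tree" "\<And>x. x \<in> ?S \<Longrightarrow> a \<le> x"
    by (auto simp: strict_predecessors_def reverse_order_on_def)
  have nz: "a \<noteq> bot" using a tree_mem nonzero by blast
  have "total_on ?S ?r"
    using comparable_above[OF _ _ nz] S tree_mem
    unfolding total_on_def reverse_order_on_def by blast
  moreover have "partial_order_on ?S ?r"
    using S(1)
    by (auto simp: partial_order_on_def preorder_on_def refl_on_def reverse_order_on_def
        intro!: transI antisymI)
  moreover have "wf (?r - Id)"
  proof (rule wfI_min)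
    fix x Q assume x: "x \<in> (Q :: 'a set)"
    show "\<exists>z\<in>Q. \<forall>y. (y, z) \<in> ?r - Id \<longrightarrow> y \<notin> Q"
    proof (cases "Q \<inter> ?S = {}")
      case True
      then show ?thesis using x by blast
    next
      case False
      then obtain q where q: "q \<in> Q \<inter> ?S" by blast
      \<comment> \<open>The greatest element in the frame order is minimal for the reversed
        order.\<close>
      have "Sup (Q \<inter> ?S) \<in> Q \<inter> ?S"
        by (rule tree_has_greatest[OF nz _ q]) (use S in auto)
      moreover have "y = Sup (Q \<inter> ?S)"
        if "(y, Sup (Q \<inter> ?S)) \<in> ?r" "y \<in> Q" for y
        using that by (intro antisym Sup_upper) (auto simp: reverse_order_on_def)
      ultimately show ?thesis by blast
    qed
  qed
  ultimately show "well_order_on ?S ?r"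
    by (simp add: well_order_on_def linear_order_on_def)
qed

end

theorem theorem3p10:
  fixes B :: "'a::non_archimedean_frame set"
  assumes "non_archimedean_base B"
  shows "\<exists>C :: 'a set. frame_base C \<and> tree_order_on C (reverse_order_on C)"
proof -
  have B: "frame_base B" using assms by (simp add: non_archimedean_base_def)
  have "non_archimedean_family (B - {bot})"
    using assms by (auto simp: non_archimedean_base_def non_archimedean_family_def)
  then obtain M where M: "B - {bot} \<subseteq> M" "non_archimedean_family M"
    "\<And>N. non_archimedean_family N \<Longrightarrow> M \<subseteq> N \<Longrightarrow> N = M"
    by (rule ex_maximal_non_archimedean_family) blast
  \<comment> \<open>Removing \<open>bot\<close> does no harm, as it is the least element.\<close>
  have "b \<le> Sup {c \<in> M. c \<le> b}" if "b \<in> B" for b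
    using that M(1) by (cases "b = bot") (auto intro: Sup_upper)
  then have "frame_base M" by (rule frame_base_refine[OF B])
  then interpret maximal_non_archimedean_base M
    using M(2,3) by unfold_locales
  show ?thesis using tree_frame_base tree_tree_order by blast
qed

end
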